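(* Let $(a_0(n))_n$ and $(a_1(n))_n$ be real sequences with $2a_0(n)+a_1(n)=1$ for all $n$, and let $U_n^{M,1}$ be the associated modified genuine Bernstein-Durrmeyer operators. Let $f\in C[0,1]$, $x\in[0,1]$, $n\ge1$. Then \begin{align*} \left|U_n^{M,1}(f;x)-f(x)\right|&\le\left|U_n(f;x)-f(x)\right|\\ &\quad+\left|(1+a_1(n))\left(\tfrac12-x\right)\right|\left\{3\,\omega_2\!\left(f;\sqrt{\sigma_n(x)}\right)+\frac5{n\sqrt{\sigma_n(x)}}\,\omega_1\!\left(f;\sqrt{\sigma_n(x)}\right)\right\}, \end{align*} where $$\sigma_n(x)=\frac{\left[2nx(1-x)+(1-2x)^2\right](n-1)}{2n^2(n+1)}\le\frac1{4n}.$$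
   Context: Bernstein basis: $p_{n,k}(x)=\binom nk x^k(1-x)^{n-k}$ for $0\le k\le n$, $x\in[0,1]$ (with $0^0=1$), and $p_{n,k}=0$ if $k<0$ or $k>n$. Classical genuine Bernstein-Durrmeyer operator: $$U_n(f;x)=(1-x)^nf(0)+x^nf(1)+(n-1)\sum_{k=1}^{n-1}p_{n,k}(x)\int_0^1p_{n-2,k-1}(t)f(t)\,dt.$$ Modified basis: given real sequences $a_0(n),a_1(n)$, put $a(x,n)=a_1(n)x+a_0(n)$ and, for $0\le k\le n$, $$p_{n,k}^{M,1}(x)=a(x,n)\,p_{n-1,k}(x)+a(1-x,n)\,p_{n-1,k-1}(x).$$ Modified genuine Bernstein-Durrmeyer operator: $$U_n^{M,1}(f;x)=a(x,n)(1-x)^{n-1}f(0)+a(1-x,n)x^{n-1}f(1)+(n-1)\sum_{k=1}^{n-1}p_{n,k}^{M,1}(x)\int_0^1p_{n-2,k-1}(t)f(t)\,dt.$$ (No positivity is assumed. The condition $2a_0(n)+a_1(n)=1$ means that $U_n^{M,1}$ reproduces the constant function $1$.) Moduli, for $g\in C[0,1]$ and $\delta\ge0$: $\omega_1(g;\delta)=\sup\{|g(s)-g(t)|: s,t\in[0,1],\ |s-t|\le\delta\}$ and $\omega_2(g;\delta)=\sup\{|g(t-h)-2g(t)+g(t+h)|: 0\le h\le\delta,\ t\pm h\in[0,1]\}$.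
   Formalization: The main inequality is asserted only when σ_n(x) ≠ 0, i.e. for n ≥ 2: for n = 1 one has σ_1(x) = 0 and the term 5/(n√σ_n(x)) on the right-hand side is undefined. The bound σ_n(x) ≤ 1/(4n) is asserted for all n ≥ 1. *)

theory Defs
  imports "HOL-Analysis.Analysis"
begin

text \<open>The library polynomial \<open>Bernstein n k\<close> already vanishes for \<open>k > n\<close>; the integer
  index adds the convention \<open>p\<^sub>n\<^sub>,\<^sub>k = 0\<close> for \<open>k < 0\<close>.\<close>

definition bern :: "nat \<Rightarrow> int \<Rightarrow> real \<Rightarrow> real" where
  "bern n k x = (if k < 0 then 0 else Bernstein n (nat k) x)"

text \<open>The operators are meant for \<open>n \<ge> 1\<close>. For \<open>n = 1\<close> the sums below are empty, so the
  truncated subtraction in \<open>n - 2\<close> is harmless.\<close>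

definition durrmeyer :: "nat \<Rightarrow> (real \<Rightarrow> real) \<Rightarrow> real \<Rightarrow> real" where
  "durrmeyer n f x =
     (1 - x) ^ n * f 0 + x ^ n * f 1
     + (real n - 1) * (\<Sum>k = 1..n - 1. bern n (int k) x
         * integral {0..1} (\<lambda>t. bern (n - 2) (int k - 1) t * f t))"

definition a_lin :: "(nat \<Rightarrow> real) \<Rightarrow> (nat \<Rightarrow> real) \<Rightarrow> real \<Rightarrow> nat \<Rightarrow> real" where
  "a_lin a0 a1 x n = a1 n * x + a0 n"

definition bern_M :: "(nat \<Rightarrow> real) \<Rightarrow> (nat \<Rightarrow> real) \<Rightarrow> nat \<Rightarrow> int \<Rightarrow> real \<Rightarrow> real" where
  "bern_M a0 a1 n k x =
     a_lin a0 a1 x n * bern (n - 1) k x + a_lin a0 a1 (1 - x) n * bern (n - 1) (k - 1) x"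

definition durrmeyer_M ::
    "(nat \<Rightarrow> real) \<Rightarrow> (nat \<Rightarrow> real) \<Rightarrow> nat \<Rightarrow> (real \<Rightarrow> real) \<Rightarrow> real \<Rightarrow> real" where
  "durrmeyer_M a0 a1 n f x =
     a_lin a0 a1 x n * (1 - x) ^ (n - 1) * f 0
     + a_lin a0 a1 (1 - x) n * x ^ (n - 1) * f 1
     + (real n - 1) * (\<Sum>k = 1..n - 1. bern_M a0 a1 n (int k) x
         * integral {0..1} (\<lambda>t. bern (n - 2) (int k - 1) t * f t))"

text \<open>The suprema are taken in the reals; they are meaningful for \<open>g\<close> bounded on the unit
  interval (in particular continuous there) and \<open>\<delta> \<ge> 0\<close>.\<close>

definition omega1 :: "(real \<Rightarrow> real) \<Rightarrow> real \<Rightarrow> real" where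
  "omega1 g \<delta> = Sup {\<bar>g s - g t\<bar> | s t. s \<in> {0..1} \<and> t \<in> {0..1} \<and> \<bar>s - t\<bar> \<le> \<delta>}"

definition omega2 :: "(real \<Rightarrow> real) \<Rightarrow> real \<Rightarrow> real" where
  "omega2 g \<delta> = Sup {\<bar>g (t - h) - 2 * g t + g (t + h)\<bar> | t h.
     0 \<le> h \<and> h \<le> \<delta> \<and> t - h \<in> {0..1} \<and> t + h \<in> {0..1}}"

text \<open>For \<open>n \<ge> 1\<close> and \<open>0 \<le> x \<le> 1\<close> this vanishes exactly when \<open>n = 1\<close>. There a bound with
  \<open>sqrt (sigma n x)\<close> in a denominator has no mathematical meaning, and must not be read with
  \<open>y / 0 = 0\<close>.\<close>

definition sigma :: "nat \<Rightarrow> real \<Rightarrow> real" where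
  "sigma n x = (2 * real n * x * (1 - x) + (1 - 2 * x)\<^sup>2) * (real n - 1)
     / (2 * (real n)\<^sup>2 * (real n + 1))"

end

(*
  Both operators are combinations of the functionals F k: evaluation at 0 and 1 for k = 0, n, and
  otherwise the mean of f under the Beta(k, n - k) distribution. By the recurrence for the Bernstein
  basis, their difference is (1 + a1 n) (1/2 - x) times the p_{n-1,j}(x)-average of F (j+1) - F j.
  Replace f by a Zhuk smoothing g with step h = sqrt (sigma n x), for which
    |f - g| <= 3/4 omega2,  |g'| <= 5/h omega1,  |g''| <= 3/2 omega2 / h^2.
  A Taylor expansion of g at the mean k/n of F k shows that F k differs from g(k/n) by at most
  3/4 omega2 + 3/4 omega2 / h^2 * Var k. Consecutive means are 1/n apart, and the averaged sum of
  consecutive variances is exactly 2 sigma n x = 2 h^2, which yields the constants 3 and 5.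
*)

theory Submission
  imports Defs
begin

subsection \<open>Whitney approximation by lines\<close>

text \<open>Take \<open>c\<close> to be a maximum point of \<open>d\<close> and \<open>e\<close> its
  distance to the nearer end of the interval. One of \<open>c - e\<close>, \<open>c + e\<close> is
  then that end and contributes more than \<open>w\<close>; the other contributes a nonnegative
  amount.\<close>

lemma large_second_difference_at_hump:
  fixes d :: "real \<Rightarrow> real"
  assumes cont: "continuous_on {u..z} d" and y: "y \<in> {u..z}"
    and "d y - d u > w" "d y - d z > w"
  shows "\<exists>c e. 0 \<le> e \<and> u \<le> c - e \<and> c + e \<le> z \<and> 2 * d c - d (c - e) - d (c + e) > w"
proof -
  obtain v where v: "v \<in> {u..z}" and vmax: "\<And>t. t \<in> {u..z} \<Longrightarrow> d t \<le> d v"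
    using continuous_attains_sup[OF _ _ cont] y by fastforce
  have gt: "d v - d u > w" "d v - d z > w"
    using vmax[OF y] assms by auto
  show ?thesis
  proof (cases "v - u \<le> z - v")
    case True
    have "d (v + (v - u)) \<le> d v" using True v by (intro vmax) auto
    then show ?thesis using True v gt by (intro exI[of _ v] exI[of _ "v - u"]) auto
  next
    case False
    have "d (v - (z - v)) \<le> d v" using False v by (intro vmax) auto
    then show ?thesis using False v gt by (intro exI[of _ v] exI[of _ "z - v"]) auto
  qed
qed

text \<open>However the four endpoints are ordered, three of them form a hump or a dip whose middle
  value differs from both outer values by more than \<open>w\<close>. This contradicts the bound on
  second differences.\<close>

lemma no_large_rise_and_fall:
  fixes d :: "real \<Rightarrow> real"
  assumes cont: "continuous_on {a..b} d"
    and diff: "\<And>c e. 0 \<le> e \<Longrightarrow> a \<le> c - e \<Longrightarrow> c + e \<le> b \<Longrightarrow> \<bar>d (c - e) - 2 * d c + d (c + e)\<bar> \<le> w"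
    and rise: "a \<le> t" "t < s" "s \<le> b" "d s - d t > w"
    and fall: "a \<le> t'" "t' < s'" "s' \<le> b" "d t' - d s' > w"
  shows False
proof -
  have hump: False
    if "a \<le> u" "z \<le> b" "y \<in> {u..z}" "d y - d u > w" "d y - d z > w" for u y z
  proof -
    have "continuous_on {u..z} d" using cont that by (auto intro: continuous_on_subset)
    from large_second_difference_at_hump[OF this that(3-5)]
    obtain c e where "0 \<le> e" "u \<le> c - e" "c + e \<le> z" "2 * d c - d (c - e) - d (c + e) > w"
      by blast
    then show False using diff[of e c] that by auto
  qed
  \<comment> \<open>A dip of \<open>d\<close> is a hump of \<open>- d\<close>.\<close>
  have dip: False
    if "a \<le> u" "z \<le> b" "y \<in> {u..z}" "d u - d y > w" "d z - d y > w" for u y z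
  proof -
    have "continuous_on {u..z} (\<lambda>t. - d t)"
      using cont that by (auto intro!: continuous_on_minus intro: continuous_on_subset)
    from large_second_difference_at_hump[OF this that(3), of w] that(4,5)
    obtain c e where "0 \<le> e" "u \<le> c - e" "c + e \<le> z"
        "2 * - d c - - d (c - e) - - d (c + e) > w"
      by auto
    then show False using diff[of e c] that by auto
  qed
  show False
  proof (cases "t \<le> t'")
    case t: True
    show False
    \<comment> \<open>If the rise both starts and ends first, the outer points are \<open>t\<close>
      and \<open>s'\<close>, and the middle is the higher of \<open>s\<close> and \<open>t'\<close>.
      If the fall is nested inside the rise, either \<open>t'\<close> is a hump over
      \<open>t\<close> and \<open>s'\<close>, or \<open>t'\<close> lies below \<open>s\<close> and
      \<open>s'\<close> is a dip. The remaining orders mirror these.\<close>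
    proof (cases "s \<le> s'")
      case True
      show False
      proof (cases "d s \<le> d t'")
        case True
        then show False using hump[of t s' t'] rise fall t by auto
      next
        case False
        then show False using hump[of t s' s] rise fall \<open>s \<le> s'\<close> by auto
      qed
    next
      case False
      show False
      proof (cases "d t' - d t > w")
        case True
        then show False using hump[of t s' t'] rise fall t False by auto
      next
        case n: False
        then show False using dip[of t' s s'] rise fall t False by auto
      qed
    qed
  next
    case t: False
    show False
    proof (cases "s' \<le> s")
      case True
      show False
      proof (cases "d s' \<le> d t")
        case True
        then show False using dip[of t' s s'] rise fall t \<open>s' \<le> s\<close> by auto
      next
        case False
        then show False using dip[of t' s t] rise fall t by auto
      qed
    next
      case False
      show False
      proof (cases "d s - d s' > w")
        case True
        then show False using hump[of t s' s] rise fall t False by auto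
      next
        case n: False
        then show False using dip[of t' s t] rise fall t False by auto
      qed
    qed
  qed
qed

text \<open>The admissible slopes \<open>m\<close> are those for which \<open>f t - m * t\<close> oscillates by at most \<open>w\<close>. Each
  pair of points bounds \<open>m\<close> from both sides; if a lower bound exceeded an upper one, a slope
  strictly between them would produce both a large rise and a large fall.\<close>

lemma Whitney_linear_approximation:
  fixes f :: "real \<Rightarrow> real"
  assumes ab: "a < b" and cont: "continuous_on {a..b} f"
    and diff: "\<And>c e. 0 \<le> e \<Longrightarrow> a \<le> c - e \<Longrightarrow> c + e \<le> b \<Longrightarrow> \<bar>f (c - e) - 2 * f c + f (c + e)\<bar> \<le> w"
  obtains \<alpha> \<beta> where "\<And>t. t \<in> {a..b} \<Longrightarrow> \<bar>f t - (\<alpha> + \<beta> * t)\<bar> \<le> w / 2"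
proof -
  have le: "(f s - f t - w) / (s - t) \<le> (f s' - f t' + w) / (s' - t')"
    if "a \<le> t" "t < s" "s \<le> b" "a \<le> t'" "t' < s'" "s' \<le> b" for s t s' t'
  proof (rule ccontr)
    assume "\<not> ?thesis"
    then obtain m where m: "(f s' - f t' + w) / (s' - t') < m" "m < (f s - f t - w) / (s - t)"
      using dense by (metis not_le)
    define d where "d = (\<lambda>t. f t - m * t)"
    have "f s' - f t' + w < m * (s' - t')" "m * (s - t) < f s - f t - w"
      using m that by (auto simp: field_simps)
    then have "d s - d t > w" "d t' - d s' > w"
      by (auto simp: d_def algebra_simps)
    moreover have "continuous_on {a..b} d" unfolding d_def by (intro continuous_intros cont)
    moreover have "\<bar>d (c - e) - 2 * d c + d (c + e)\<bar> \<le> w"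
      if "0 \<le> e" "a \<le> c - e" "c + e \<le> b" for c e
      using diff[OF that] by (simp add: d_def algebra_simps)
    ultimately show False using no_large_rise_and_fall[of a b d w t s t' s'] that by blast
  qed
  define L where "L = {(f s - f t - w) / (s - t) | s t. a \<le> t \<and> t < s \<and> s \<le> b}"
  define m where "m = Sup L"
  have bdd: "bdd_above L"
    unfolding bdd_above_def L_def using le[of _ _ a b] ab by blast
  have ne: "L \<noteq> {}" using ab unfolding L_def by blast
  have bound: "\<bar>f s - f t - m * (s - t)\<bar> \<le> w" if "a \<le> t" "t < s" "s \<le> b" for s t
  proof -
    have "(f s - f t - w) / (s - t) \<le> m"
      unfolding m_def by (rule cSup_upper[OF _ bdd]) (use that in \<open>auto simp: L_def\<close>)
    moreover have "m \<le> (f s - f t + w) / (s - t)"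
      unfolding m_def by (rule cSup_least[OF ne]) (use that le in \<open>auto simp: L_def\<close>)
    ultimately show ?thesis using that by (auto simp: field_simps abs_le_iff)
  qed
  define d where "d = (\<lambda>t. f t - m * t)"
  have dw: "\<bar>d s - d t\<bar> \<le> w" if "s \<in> {a..b}" "t \<in> {a..b}" for s t
  proof -
    have "0 \<le> w" using bound[of a b] ab by linarith
    then show ?thesis using bound[of t s] bound[of s t] that
      by (cases s t rule: linorder_cases) (auto simp: d_def algebra_simps)
  qed
  have "continuous_on {a..b} d" unfolding d_def by (intro continuous_intros cont)
  then have "\<exists>p\<in>{a..b}. \<forall>t\<in>{a..b}. d t \<le> d p" "\<exists>q\<in>{a..b}. \<forall>t\<in>{a..b}. d q \<le> d t"
    using ab by (auto intro!: continuous_attains_sup continuous_attains_inf)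
  then obtain p q where p: "p \<in> {a..b}" "\<And>t. t \<in> {a..b} \<Longrightarrow> d t \<le> d p"
    and q: "q \<in> {a..b}" "\<And>t. t \<in> {a..b} \<Longrightarrow> d q \<le> d t"
    by blast
  \<comment> \<open>The intercept is the midpoint of the extreme values of \<open>d\<close>, which
    halves the oscillation bound \<open>w\<close>.\<close>
  have "\<bar>f t - ((d p + d q) / 2 + m * t)\<bar> \<le> w / 2" if "t \<in> {a..b}" for t
    using p(2)[OF that] q(2)[OF that] dw[OF p(1) q(1)] by (auto simp: d_def abs_le_iff field_simps)
  then show thesis by (rule that)
qed

text \<open>A mean value inequality tolerating finitely many points without derivative, as needed
  for primitives of a function with jumps. The derivative, set to zero at the exceptions, still
  integrates to the increment.\<close>

lemma increment_bound_finite_exceptions: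
  fixes \<phi> :: "real \<Rightarrow> real"
  assumes "finite S" "a \<le> b" "0 \<le> C" and cont: "continuous_on {a..b} \<phi>"
    and deriv: "\<And>x. x \<in> {a<..<b} - S \<Longrightarrow> (\<phi> has_real_derivative \<phi>' x) (at x)"
    and bound: "\<And>x. x \<in> {a<..<b} - S \<Longrightarrow> \<bar>\<phi>' x\<bar> \<le> C"
  shows "\<bar>\<phi> b - \<phi> a\<bar> \<le> C * (b - a)"
proof -
  define \<psi> where "\<psi> x = (if x \<in> {a<..<b} - S then \<phi>' x else 0)" for x
  have "(\<psi> has_integral (\<phi> b - \<phi> a)) {a..b}"
    by (rule fundamental_theorem_of_calculus_interior_strong[OF \<open>finite S\<close> \<open>a \<le> b\<close> _ cont])
      (use deriv in \<open>auto simp: \<psi>_def has_real_derivative_iff_has_vector_derivative[symmetric]\<close>)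
  moreover have "norm (\<psi> x) \<le> C" for x
    using bound[of x] \<open>0 \<le> C\<close> by (auto simp: \<psi>_def)
  ultimately show ?thesis
    using has_integral_bound[of C \<psi> "\<phi> b - \<phi> a" a b] \<open>0 \<le> C\<close> \<open>a \<le> b\<close>
    by (auto simp: content_real)
qed

text \<open>Adding the Taylor remainder to, or subtracting it from,
  \<open>C / 2 * (x - a)\<^sup>2\<close> gives a function vanishing at \<open>a\<close> that
  decreases to the left of \<open>a\<close> and increases to the right of it, hence is nonnegative
  at \<open>b\<close>.\<close>

lemma Taylor_bound_Lipschitz_derivative:
  fixes \<phi> \<psi> :: "real \<Rightarrow> real"
  assumes ab: "a \<in> {p..q}" "b \<in> {p..q}"
    and deriv: "\<And>x. x \<in> {p..q} \<Longrightarrow> (\<phi> has_real_derivative \<psi> x) (at x)"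
    and lip: "\<And>x. x \<in> {p..q} \<Longrightarrow> \<bar>\<psi> x - \<psi> a\<bar> \<le> C * \<bar>x - a\<bar>"
  shows "\<bar>\<phi> b - \<phi> a - \<psi> a * (b - a)\<bar> \<le> C / 2 * (b - a)\<^sup>2"
proof -
  define r where "r = (\<lambda>\<epsilon> x. C / 2 * (x - a)\<^sup>2 + \<epsilon> * (\<phi> x - \<phi> a - \<psi> a * (x - a)))"
  have dr: "(r \<epsilon> has_real_derivative (C * (x - a) + \<epsilon> * (\<psi> x - \<psi> a))) (at x)"
    if "x \<in> {p..q}" for x \<epsilon>
    unfolding r_def
    by (rule derivative_eq_intros deriv[OF that] refl | simp add: algebra_simps)+
  have "r \<epsilon> b \<ge> r \<epsilon> a" if \<epsilon>: "\<epsilon> = 1 \<or> \<epsilon> = -1" for \<epsilon>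
  proof (cases "a \<le> b")
    case True
    have "\<exists>y. (r \<epsilon> has_real_derivative y) (at x) \<and> y \<ge> 0" if "a \<le> x" "x \<le> b" for x
      using dr[of x \<epsilon>] lip[of x] that ab \<epsilon> by (intro exI[of _ "C * (x - a) + \<epsilon> * (\<psi> x - \<psi> a)"]) auto
    then show ?thesis using DERIV_nonneg_imp_nondecreasing[OF True, of "r \<epsilon>"] by blast
  next
    case False
    have "\<exists>y. (r \<epsilon> has_real_derivative y) (at x) \<and> y \<le> 0" if "b \<le> x" "x \<le> a" for x
      using dr[of x \<epsilon>] lip[of x] that ab \<epsilon>
      by (intro exI[of _ "C * (x - a) + \<epsilon> * (\<psi> x - \<psi> a)"]) (auto simp: algebra_simps)
    then show ?thesis using DERIV_nonpos_imp_nonincreasing[of b a "r \<epsilon>"] False by auto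
  qed
  from this[of 1] this[of "-1"]
  have "0 \<le> C / 2 * (b - a)\<^sup>2 + (\<phi> b - \<phi> a - \<psi> a * (b - a))"
    "0 \<le> C / 2 * (b - a)\<^sup>2 - (\<phi> b - \<phi> a - \<psi> a * (b - a))"
    by (simp_all add: r_def)
  then show ?thesis by linarith
qed

subsection \<open>Zhuk smoothing\<close>

text \<open>\<open>f\<close> is extended beyond the unit interval by its near-best lines on the two end intervals of
  length \<open>2 * h\<close>, and \<open>g\<close> is the normalised second difference of a second primitive of this
  extension \<open>F\<close>. Since \<open>F\<close> may jump at 0 and 1, \<open>g'\<close> is only piecewise differentiable.\<close>

lemma Zhuk_smoothing:
  fixes f :: "real \<Rightarrow> real"
  assumes h: "0 < h" "h \<le> 1 / 2" and cont: "continuous_on {0..1} f"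
    and w1: "\<And>s t. s \<in> {0..1} \<Longrightarrow> t \<in> {0..1} \<Longrightarrow> \<bar>s - t\<bar> \<le> h \<Longrightarrow> \<bar>f s - f t\<bar> \<le> w1"
    and w2: "\<And>c e. 0 \<le> e \<Longrightarrow> e \<le> h \<Longrightarrow> 0 \<le> c - e \<Longrightarrow> c + e \<le> 1 \<Longrightarrow>
               \<bar>f (c - e) - 2 * f c + f (c + e)\<bar> \<le> w2"
    and w21: "w2 \<le> 2 * w1"
  obtains g g' where
    "\<And>x. x \<in> {0..1} \<Longrightarrow> (g has_real_derivative g' x) (at x)"
    "\<And>x. x \<in> {0..1} \<Longrightarrow> \<bar>f x - g x\<bar> \<le> 3 / 4 * w2"
    "\<And>x. x \<in> {0..1} \<Longrightarrow> \<bar>g' x\<bar> \<le> 5 / h * w1"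
    "\<And>x y. x \<in> {0..1} \<Longrightarrow> y \<in> {0..1} \<Longrightarrow> \<bar>g' x - g' y\<bar> \<le> 3 / 2 * w2 / h\<^sup>2 * \<bar>x - y\<bar>"
proof -
  have w2_nonneg: "0 \<le> w2" using w2[of 0 0] h by simp
  have "continuous_on {0..2 * h} f" "continuous_on {1 - 2 * h..1} f"
    using cont h by (auto elim!: continuous_on_subset)
  note conts = this
  \<comment> \<open>An interval of length \<open>2 * h\<close> only admits steps
    \<open>e \<le> h\<close>, so \<open>w2\<close> bounds all its second differences.\<close>
  obtain \<alpha> \<beta> where left: "\<And>t. t \<in> {0..2 * h} \<Longrightarrow> \<bar>f t - (\<alpha> + \<beta> * t)\<bar> \<le> w2 / 2"
    by (rule Whitney_linear_approximation[OF _ conts(1), of w2]) (use h w2 in auto)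
  obtain \<gamma> \<delta> where right: "\<And>t. t \<in> {1 - 2 * h..1} \<Longrightarrow> \<bar>f t - (\<gamma> + \<delta> * t)\<bar> \<le> w2 / 2"
    by (rule Whitney_linear_approximation[OF _ conts(2), of w2]) (use h w2 in auto)
  define F where "F x = (if x < 0 then \<alpha> + \<beta> * x else if x \<le> 1 then f x else \<gamma> + \<delta> * x)" for x
  \<comment> \<open>When one argument leaves the unit interval, subtract the line \<open>l\<close>
    used there: what remains is the error \<open>f - l\<close> at one point minus twice that error
    at \<open>x\<close>, hence at most \<open>w2 / 2 + w2\<close>.\<close>
  have F_diff2: "\<bar>F (x + t) - 2 * F x + F (x - t)\<bar> \<le> 3 / 2 * w2"
    if "x \<in> {0..1}" "0 \<le> t" "t \<le> h" for x t
  proof -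
    consider "x < t" | "t \<le> x" "x + t \<le> 1" | "1 < x + t" by linarith
    then show ?thesis
    proof cases
      case 1
      then have "F (x - t) = \<alpha> + \<beta> * x - \<beta> * t" "F x = f x" "F (x + t) = f (x + t)"
        using that h by (auto simp: F_def algebra_simps)
      moreover have "\<bar>f x - (\<alpha> + \<beta> * x)\<bar> \<le> w2 / 2" "\<bar>f (x + t) - (\<alpha> + \<beta> * (x + t))\<bar> \<le> w2 / 2"
        using left[of x] left[of "x + t"] 1 that h by auto
      ultimately show ?thesis unfolding distrib_left by linarith
    next
      case 2
      then have "F (x - t) = f (x - t)" "F x = f x" "F (x + t) = f (x + t)"
        using that by (auto simp: F_def)
      then show ?thesis using w2[of t x] 2 that w2_nonneg by linarith
    next
      case 3
      then have "F (x + t) = \<gamma> + \<delta> * x + \<delta> * t" "F x = f x" "F (x - t) = f (x - t)"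
        using that h by (auto simp: F_def algebra_simps)
      moreover have "\<bar>f x - (\<gamma> + \<delta> * x)\<bar> \<le> w2 / 2" "\<bar>f (x - t) - (\<gamma> + \<delta> * (x - t))\<bar> \<le> w2 / 2"
        using right[of x] right[of "x - t"] 3 that h by auto
      ultimately show ?thesis unfolding right_diff_distrib by linarith
    qed
  qed
  \<comment> \<open>Over length \<open>2 * h\<close> the function changes by at most
    \<open>2 * w1\<close>, and the two approximation errors add at most
    \<open>w2 \<le> 2 * w1\<close>.\<close>
  have slope: "\<bar>c * (2 * t)\<bar> \<le> 4 * w1"
    if "\<bar>f p - (b + c * p)\<bar> \<le> w2 / 2" "\<bar>f (p + 2 * h) - (b + c * (p + 2 * h))\<bar> \<le> w2 / 2"
      "0 \<le> p" "p + 2 * h \<le> 1" "0 \<le> t" "t \<le> h" for b c p t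
  proof -
    have "\<bar>f (p + h) - f p\<bar> \<le> w1" "\<bar>f (p + 2 * h) - f (p + h)\<bar> \<le> w1"
      using that h by (auto intro!: w1)
    then have "\<bar>c * (2 * h)\<bar> \<le> 4 * w1"
      using that(1,2) w21 unfolding distrib_left by linarith
    moreover have "\<bar>c * (2 * t)\<bar> \<le> \<bar>c * (2 * h)\<bar>"
      using that h by (auto simp: abs_mult intro!: mult_right_mono)
    ultimately show ?thesis by linarith
  qed
  \<comment> \<open>Outside the unit interval the line contributes at most \<open>4 * w1\<close>,
    and the error at the point still inside at most \<open>w2 / 2 \<le> w1\<close>.\<close>
  have F_diff1: "\<bar>F (x + t) - F (x - t)\<bar> \<le> 5 * w1"
    if "x \<in> {0..1}" "0 \<le> t" "t \<le> h" for x t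
  proof -
    consider "x < t" | "t \<le> x" "x + t \<le> 1" | "1 < x + t" by linarith
    then show ?thesis
    proof cases
      case 1
      then have "F (x - t) = \<alpha> + \<beta> * x - \<beta> * t" "F (x + t) = f (x + t)"
        using that h by (auto simp: F_def algebra_simps)
      moreover have "\<bar>f (x + t) - (\<alpha> + \<beta> * (x + t))\<bar> \<le> w2 / 2"
        using left[of "x + t"] 1 that h by auto
      moreover have "\<bar>\<beta> * (2 * t)\<bar> \<le> 4 * w1"
        using left[of 0] left[of "2 * h"] h that by (intro slope[of 0 \<alpha>]) auto
      ultimately show ?thesis using w21 unfolding distrib_left by linarith
    next
      case 2
      have "\<bar>f (x + t) - f x\<bar> \<le> w1" "\<bar>f x - f (x - t)\<bar> \<le> w1"
        using that 2 by (auto intro!: w1)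
      then show ?thesis using that 2 by (auto simp: F_def)
    next
      case 3
      then have "F (x + t) = \<gamma> + \<delta> * x + \<delta> * t" "F (x - t) = f (x - t)"
        using that h by (auto simp: F_def algebra_simps)
      moreover have "\<bar>f (x - t) - (\<gamma> + \<delta> * (x - t))\<bar> \<le> w2 / 2"
        using right[of "x - t"] 3 that h by auto
      moreover have "\<bar>\<delta> * (2 * t)\<bar> \<le> 4 * w1"
        using right[of 1] right[of "1 - 2 * h"] h that by (intro slope[of "1 - 2 * h" \<gamma>]) auto
      ultimately show ?thesis using w21 unfolding distrib_left right_diff_distrib by linarith
    qed
  qed
  have F_int: "F integrable_on {-1..2}"
  proof -
    have "F integrable_on {-1..0}"
      by (rule integrable_spike[of "\<lambda>x. \<alpha> + \<beta> * x" _ "{0}"])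
        (auto simp: F_def intro!: integrable_continuous_real continuous_intros)
    moreover have "F integrable_on {0..1}"
      by (rule integrable_eq[of f]) (auto simp: F_def intro!: integrable_continuous_real cont)
    moreover have "F integrable_on {1..2}"
      by (rule integrable_spike[of "\<lambda>x. \<gamma> + \<delta> * x" _ "{1}"])
        (auto simp: F_def intro!: integrable_continuous_real continuous_intros)
    ultimately show ?thesis
      using Henstock_Kurzweil_Integration.integrable_combine[of "-1" 0 1 F]
        Henstock_Kurzweil_Integration.integrable_combine[of "-1" 1 2 F] by auto
  qed
  \<comment> \<open>Since \<open>h \<le> 1 / 2\<close>, all arguments \<open>x\<close>,
    \<open>x + h\<close>, \<open>x - h\<close> with \<open>x\<close> in the unit interval lie
    strictly between -1 and 2.\<close>
  define G where "G x = integral {-1..x} F" for x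
  define H where "H x = integral {-1..x} G" for x
  have G_cont: "continuous_on {-1..2} G"
    unfolding G_def by (rule indefinite_integral_continuous_1[OF F_int])
  have F_cont: "isCont F x" if "x \<noteq> 0" "x \<noteq> 1" for x
  proof -
    consider "x \<in> {..<0}" | "x \<in> {0<..<1}" | "x \<in> {1<..}" using \<open>x \<noteq> 0\<close> \<open>x \<noteq> 1\<close> by fastforce
    then show ?thesis
    proof cases
      case 1
      have "continuous_on {..<0} F \<longleftrightarrow> continuous_on {..<0} (\<lambda>x. \<alpha> + \<beta> * x)"
        by (rule continuous_on_cong) (auto simp: F_def)
      then have "continuous_on {..<0} F" by (auto intro!: continuous_intros)
      then show ?thesis using 1 by (simp add: continuous_on_eq_continuous_at)
    next
      case 2
      have "continuous_on {0<..<1} F \<longleftrightarrow> continuous_on {0<..<1} f"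
        by (rule continuous_on_cong) (auto simp: F_def)
      moreover have "continuous_on {0<..<1} f"
        by (rule continuous_on_subset[OF cont]) auto
      ultimately show ?thesis using 2 by (simp add: continuous_on_eq_continuous_at)
    next
      case 3
      have "continuous_on {1<..} F \<longleftrightarrow> continuous_on {1<..} (\<lambda>x. \<gamma> + \<delta> * x)"
        by (rule continuous_on_cong) (auto simp: F_def)
      then have "continuous_on {1<..} F" by (auto intro!: continuous_intros)
      then show ?thesis using 3 by (simp add: continuous_on_eq_continuous_at)
    qed
  qed
  have G_deriv: "(G has_real_derivative F x) (at x)" if "-1 < x" "x < 2" "x \<noteq> 0" "x \<noteq> 1" for x
  proof -
    have "(G has_vector_derivative F x) (at x within {-1..2} - {})"
      unfolding G_def
      by (rule integral_has_vector_derivative_continuous_at[OF F_int])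
        (use that F_cont[of x] in \<open>auto intro: continuous_at_imp_continuous_within\<close>)
    moreover have "at x within {-1..2} = at x" using that by (intro at_within_interior) auto
    ultimately show ?thesis by (simp add: has_real_derivative_iff_has_vector_derivative)
  qed
  have H_deriv: "(H has_real_derivative G x) (at x)" if "-1 < x" "x < 2" for x
  proof -
    have "(H has_real_derivative G x) (at x within {-1..2})"
      unfolding H_def by (rule integral_has_real_derivative[OF G_cont]) (use that in auto)
    moreover have "at x within {-1..2} = at x" using that by (intro at_within_interior) auto
    ultimately show ?thesis by simp
  qed
  \<comment> \<open>Stating \<open>D\<close> through an equation lets the rule be used together with
    \<open>derivative_eq_intros\<close>. The points 0 and 1 are excluded because \<open>F\<close>
    may jump there; \<open>G\<close> is continuous, so \<open>H_chain\<close> needs no such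
    exclusion.\<close>
  have G_chain: "((\<lambda>t. G (u t)) has_real_derivative D) (at t)"
    if "(u has_real_derivative u') (at t)" "-1 < u t" "u t < 2" "u t \<noteq> 0" "u t \<noteq> 1"
      "D = F (u t) * u'" for u u' t D
    unfolding that(6) using that by (intro DERIV_chain2[OF G_deriv]) auto
  have H_chain: "((\<lambda>t. H (u t)) has_real_derivative D) (at t)"
    if "(u has_real_derivative u') (at t)" "-1 < u t" "u t < 2" "D = G (u t) * u'" for u u' t D
    unfolding that(4) using that by (intro DERIV_chain2[OF H_deriv]) auto
  have G_comp: "continuous_on S (\<lambda>t. G (u t))"
    if "continuous_on S u" "u ` S \<subseteq> {-1..2}" for S and u :: "real \<Rightarrow> real"
    by (rule continuous_on_compose2[OF G_cont that])

  define g where "g x = (H (x + h) - 2 * H x + H (x - h)) / h\<^sup>2" for x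
  define g' where "g' x = (G (x + h) - 2 * G x + G (x - h)) / h\<^sup>2" for x
  show thesis
  proof
    show "(g has_real_derivative g' x) (at x)" if "x \<in> {0..1}" for x
      unfolding g_def[abs_def] g'_def using that h
      by (intro DERIV_cdivide) (auto intro!: derivative_eq_intros H_chain)
  next
    fix x :: real assume x: "x \<in> {0..1}"
    \<comment> \<open>This is the derivative in \<open>t\<close> of the function
      \<open>\<phi>\<close> below, and its own derivative is a second difference of
      \<open>F\<close>. Integrating \<open>F_diff2\<close> twice from 0 to \<open>h\<close> yields
      half of \<open>3 / 2 * w2 * h\<^sup>2\<close>; the exceptional set collects the
      \<open>t\<close> for which \<open>x + t\<close> or \<open>x - t\<close> is 0 or 1.\<close>
    define \<psi> where "\<psi> t = G (x + t) - G (x - t) - 2 * t * f x" for t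
    have \<psi>_bound: "\<bar>\<psi> t\<bar> \<le> 3 / 2 * w2 * t" if t: "t \<in> {0..h}" for t
    proof -
      have "\<bar>\<psi> t - \<psi> 0\<bar> \<le> 3 / 2 * w2 * (t - 0)"
      proof (rule increment_bound_finite_exceptions[where S = "{- x, 1 - x, x, x - 1}" and
            \<phi>' = "\<lambda>t. F (x + t) + F (x - t) - 2 * f x"])
        show "continuous_on {0..t} \<psi>"
          unfolding \<psi>_def[abs_def] using x t h by (intro continuous_intros G_comp) auto
        show "(\<psi> has_real_derivative (F (x + s) + F (x - s) - 2 * f x)) (at s)"
          if "s \<in> {0<..<t} - {- x, 1 - x, x, x - 1}" for s
          unfolding \<psi>_def[abs_def] using that x t h
          by (auto intro!: derivative_eq_intros G_chain)
        show "\<bar>F (x + s) + F (x - s) - 2 * f x\<bar> \<le> 3 / 2 * w2"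
          if "s \<in> {0<..<t} - {- x, 1 - x, x, x - 1}" for s
        proof -
          have "F x = f x" using x by (simp add: F_def)
          then show ?thesis using F_diff2[OF x, of s] that t by (simp add: algebra_simps)
        qed
      qed (use t w2_nonneg in auto)
      then show ?thesis by (simp add: \<psi>_def)
    qed
    define \<phi> where "\<phi> t = H (x + t) - 2 * H x + H (x - t) - t\<^sup>2 * f x" for t
    have "\<bar>\<phi> h - \<phi> 0 - \<psi> 0 * (h - 0)\<bar> \<le> 3 / 2 * w2 / 2 * (h - 0)\<^sup>2"
    proof (rule Taylor_bound_Lipschitz_derivative[where p = 0 and q = h])
      show "(\<phi> has_real_derivative \<psi> t) (at t)" if "t \<in> {0..h}" for t
        unfolding \<phi>_def[abs_def] \<psi>_def using that x h
        by (auto intro!: derivative_eq_intros H_chain)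
      show "\<bar>\<psi> t - \<psi> 0\<bar> \<le> 3 / 2 * w2 * \<bar>t - 0\<bar>" if "t \<in> {0..h}" for t
        using \<psi>_bound[OF that] that by (simp add: \<psi>_def)
    qed (use h in auto)
    then have "\<bar>\<phi> h\<bar> \<le> 3 / 4 * w2 * h\<^sup>2" by (simp add: \<phi>_def \<psi>_def)
    moreover have "f x - g x = - \<phi> h / h\<^sup>2" using h by (simp add: g_def \<phi>_def field_simps)
    ultimately show "\<bar>f x - g x\<bar> \<le> 3 / 4 * w2" using h by (simp add: abs_divide divide_le_eq)
  next
    fix x :: real assume x: "x \<in> {0..1}"
    \<comment> \<open>Its derivative is the symmetric first difference bounded in
      \<open>F_diff1\<close>; one integration gains only a factor \<open>h\<close> against the
      division by \<open>h\<^sup>2\<close>.\<close>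
    define \<psi> where "\<psi> t = G (x + t) - 2 * G x + G (x - t)" for t
    have "\<bar>\<psi> h - \<psi> 0\<bar> \<le> 5 * w1 * (h - 0)"
    proof (rule increment_bound_finite_exceptions[where S = "{- x, 1 - x, x, x - 1}" and
          \<phi>' = "\<lambda>t. F (x + t) - F (x - t)"])
      show "continuous_on {0..h} \<psi>"
        unfolding \<psi>_def[abs_def] using x h by (intro continuous_intros G_comp) auto
      show "(\<psi> has_real_derivative (F (x + s) - F (x - s))) (at s)"
        if "s \<in> {0<..<h} - {- x, 1 - x, x, x - 1}" for s
        unfolding \<psi>_def[abs_def] using that x h
        by (auto intro!: derivative_eq_intros G_chain)
    qed (use h w21 w2_nonneg F_diff1[OF x] in auto)
    then have "\<bar>\<psi> h\<bar> \<le> 5 * w1 * h" by (simp add: \<psi>_def)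
    then have "\<bar>\<psi> h\<bar> / h\<^sup>2 \<le> 5 * w1 * h / h\<^sup>2" by (rule divide_right_mono) simp
    moreover have "\<bar>g' x\<bar> = \<bar>\<psi> h\<bar> / h\<^sup>2" by (simp add: g'_def \<psi>_def abs_divide)
    moreover have "5 * w1 * h / h\<^sup>2 = 5 / h * w1" using h by (simp add: power2_eq_square)
    ultimately show "\<bar>g' x\<bar> \<le> 5 / h * w1" by simp
  next
    have le: "\<bar>g' y - g' x\<bar> \<le> 3 / 2 * w2 / h\<^sup>2 * (y - x)"
      if xy: "x \<le> y" "x \<in> {0..1}" "y \<in> {0..1}" for x y
    proof (rule increment_bound_finite_exceptions[where S = "{0, 1, - h, 1 - h, h, 1 + h}" and
          \<phi>' = "\<lambda>t. (F (t + h) - 2 * F t + F (t - h)) / h\<^sup>2"])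
      show "continuous_on {x..y} g'"
        unfolding g'_def[abs_def] using xy h by (intro continuous_intros G_comp) auto
      show "(g' has_real_derivative ((F (t + h) - 2 * F t + F (t - h)) / h\<^sup>2)) (at t)"
        if "t \<in> {x<..<y} - {0, 1, - h, 1 - h, h, 1 + h}" for t
        unfolding g'_def[abs_def] using that xy h
        by (intro DERIV_cdivide) (auto intro!: derivative_eq_intros G_chain)
      show "\<bar>(F (t + h) - 2 * F t + F (t - h)) / h\<^sup>2\<bar> \<le> 3 / 2 * w2 / h\<^sup>2"
        if "t \<in> {x<..<y} - {0, 1, - h, 1 - h, h, 1 + h}" for t
      proof -
        have "\<bar>F (t + h) - 2 * F t + F (t - h)\<bar> / h\<^sup>2 \<le> 3 / 2 * w2 / h\<^sup>2"
          using that xy h by (intro divide_right_mono F_diff2) auto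
        then show ?thesis by (simp add: abs_divide)
      qed
    qed (use xy w2_nonneg in auto)
    show "\<bar>g' x - g' y\<bar> \<le> 3 / 2 * w2 / h\<^sup>2 * \<bar>x - y\<bar>" if "x \<in> {0..1}" "y \<in> {0..1}" for x y
      using le[of x y] le[of y x] that by (cases "x \<le> y") (auto simp: abs_minus_commute)
  qed
qed

subsection \<open>Beta means\<close>

lemma has_integral_Bernstein:
  assumes "j \<le> m"
  shows "(Bernstein m j has_integral 1 / (real m + 1)) {0..1}"
proof -
  have "((\<lambda>t. t powr (real (j + 1) - 1) * (1 - t) powr (real (m - j + 1) - 1)) has_integral
          Beta (real (j + 1)) (real (m - j + 1))) {0..1}"
    by (rule has_integral_Beta_real) auto
  then have "((\<lambda>t. t ^ j * (1 - t) ^ (m - j)) has_integral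
          Beta (real (j + 1)) (real (m - j + 1))) {0..1}"
    \<comment> \<open>\<open>powr\<close> and \<open>^\<close> can disagree at the endpoints,
      because \<open>0 powr 0 = 0\<close>.\<close>
    by (rule has_integral_spike[of "{0, 1}", rotated 2]) (auto simp: powr_realpow)
  also have "Beta (real (j + 1)) (real (m - j + 1)) = fact j * fact (m - j) / fact (m + 1)"
    using Gamma_fact[of j, where 'a = real] Gamma_fact[of "m - j", where 'a = real]
      Gamma_fact[of "m + 1", where 'a = real] assms
    by (simp add: Beta_def add_ac of_nat_diff)
  finally have "((\<lambda>t. real (m choose j) * (t ^ j * (1 - t) ^ (m - j))) has_integral
          real (m choose j) * (fact j * fact (m - j) / fact (m + 1))) {0..1}"
    by (rule has_integral_mult_right)
  moreover have "real (m choose j) * (fact j * fact (m - j) / fact (m + 1)) = 1 / (real m + 1)"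
    by (simp add: binomial_fact[OF assms] divide_simps)
  ultimately show ?thesis by (simp add: Bernstein_def[abs_def] mult_ac)
qed

text \<open>Multiplication by \<open>t\<close> raises degree and index by one, so moments of
  Bernstein polynomials reduce to plain integrals.\<close>

lemma mult_Bernstein:
  "t * Bernstein m j t = (real j + 1) / (real m + 1) * Bernstein (Suc m) (Suc j) t"
proof -
  have "(real j + 1) * real (Suc m choose Suc j) = (real m + 1) * real (m choose j)"
    using Suc_times_binomial[of j m] by (metis of_nat_Suc of_nat_mult add.commute)
  then have *: "(real j + 1) / (real m + 1) * real (Suc m choose Suc j) = real (m choose j)"
    by (simp add: divide_simps)
  have "t * Bernstein m j t = real (m choose j) * (t ^ Suc j * (1 - t) ^ (Suc m - Suc j))"
    by (simp add: Bernstein_def)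
  then show ?thesis unfolding *[symmetric] by (simp add: Bernstein_def del: binomial_Suc_Suc)
qed

lemma has_integral_Bernstein_quadratic:
  assumes "j \<le> m"
  shows "((\<lambda>t. Bernstein m j t * (c0 + c1 * t + c2 * t\<^sup>2)) has_integral
    (c0 + c1 * (real j + 1) / (real m + 2)
      + c2 * ((real j + 1) * (real j + 2)) / ((real m + 2) * (real m + 3))) / (real m + 1)) {0..1}"
proof -
  define d1 where "d1 = c1 * ((real j + 1) / (real m + 1))"
  define d2 where "d2 = c2 * ((real j + 1) / (real m + 1) * ((real j + 2) / (real m + 2)))"
  have "((\<lambda>t. c0 * Bernstein m j t + d1 * Bernstein (Suc m) (Suc j) t
         + d2 * Bernstein (Suc (Suc m)) (Suc (Suc j)) t) has_integral
       c0 * (1 / (real m + 1)) + d1 * (1 / (real (Suc m) + 1)) + d2 * (1 / (real (Suc (Suc m)) + 1))) {0..1}"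
    using assms by (intro has_integral_add has_integral_mult_right has_integral_Bernstein) auto
  moreover have "c0 * Bernstein m j t + d1 * Bernstein (Suc m) (Suc j) t
         + d2 * Bernstein (Suc (Suc m)) (Suc (Suc j)) t
       = Bernstein m j t * (c0 + c1 * t + c2 * t\<^sup>2)" for t
  proof -
    have "Bernstein m j t * (c0 + c1 * t + c2 * t\<^sup>2)
        = c0 * Bernstein m j t + c1 * (t * Bernstein m j t) + c2 * (t * (t * Bernstein m j t))"
      by (simp add: algebra_simps power2_eq_square)
    also have "t * (t * Bernstein m j t)
        = (real j + 1) / (real m + 1) * (t * Bernstein (Suc m) (Suc j) t)"
      by (subst mult_Bernstein) simp
    finally show ?thesis
      unfolding mult_Bernstein d1_def d2_def by (simp add: add_ac mult_ac)
  qed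
  moreover have "c0 * (1 / (real m + 1)) + d1 * (1 / (real (Suc m) + 1)) + d2 * (1 / (real (Suc (Suc m)) + 1))
     = (c0 + c1 * (real j + 1) / (real m + 2)
      + c2 * ((real j + 1) * (real j + 2)) / ((real m + 2) * (real m + 3))) / (real m + 1)"
  proof -
    have "d1 * (1 / (real (Suc m) + 1)) = c1 * (real j + 1) / (real m + 2) / (real m + 1)"
      "d2 * (1 / (real (Suc (Suc m)) + 1))
        = c2 * ((real j + 1) * (real j + 2)) / ((real m + 2) * (real m + 3)) / (real m + 1)"
      by (simp_all add: d1_def d2_def add_ac mult_ac)
    then show ?thesis by (simp only: add_divide_distrib) simp
  qed
  ultimately show ?thesis by simp
qed

text \<open>The factor \<open>real n - 1\<close> normalises the weight, as a Bernstein polynomial of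
  degree \<open>n - 2\<close> integrates to \<open>1 / (n - 1)\<close>. The end cases are point
  masses, which turns both operators into plain sums over \<open>k \<le> n\<close>.\<close>

definition beta_mean :: "nat \<Rightarrow> (real \<Rightarrow> real) \<Rightarrow> nat \<Rightarrow> real" where
  "beta_mean n f k = (if k = 0 then f 0 else if k = n then f 1
     else (real n - 1) * integral {0..1} (\<lambda>t. bern (n - 2) (int k - 1) t * f t))"

text \<open>The bound on the right is evaluated with the variance of the Beta distribution with
  parameters \<open>k\<close> and \<open>n - k\<close>, whose mean is \<open>k / n\<close>.\<close>

lemma beta_mean_near_linear:
  assumes k: "k \<le> n" and cont: "continuous_on {0..1} f"
    and bound: "\<And>t. t \<in> {0..1} \<Longrightarrow>
      \<bar>f t - (c + d * (t - real k / real n))\<bar> \<le> e + M * (t - real k / real n)\<^sup>2"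
  shows "\<bar>beta_mean n f k - c\<bar>
    \<le> e + M * (real k * (real n - real k) / ((real n)\<^sup>2 * (real n + 1)))"
proof -
  consider "k = 0" | "0 < k" "k = n" | "0 < k" "k < n" using k by linarith
  then show ?thesis
  proof cases
    \<comment> \<open>At either end \<open>k / n\<close> is the evaluation point itself, so the
      linear, quadratic and variance terms all vanish.\<close>
    case 1
    then show ?thesis using bound[of 0] by (simp add: beta_mean_def)
  next
    case 2
    then show ?thesis using bound[of 1] by (simp add: beta_mean_def)
  next
    case 3
    define m where "m = n - 2"
    define j where "j = k - 1"
    have kj: "k = Suc j" and nm: "n = m + 2" and jm: "j \<le> m"
      using 3 by (auto simp: m_def j_def)
    define b where "b = real k / real n"
    define v where "v = b * (1 - b) / (real n + 1)"
    let ?B = "Bernstein m j"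
    \<comment> \<open>The slope \<open>d\<close> drops out because \<open>b\<close> is the mean of
      the normalised weight; in \<open>quad\<close>, \<open>v\<close> is its variance.\<close>
    have lin: "((\<lambda>t. ?B t * (c + d * (t - b))) has_integral c / (real n - 1)) {0..1}"
      using has_integral_Bernstein_quadratic[OF jm, of "c - d * b" d 0]
      by (simp add: b_def kj nm algebra_simps)
    have quad: "((\<lambda>t. ?B t * (e + M * (t - b)\<^sup>2)) has_integral (e + M * v) / (real n - 1)) {0..1}"
    proof -
      have "e + M * b\<^sup>2 + - 2 * M * b * (real j + 1) / (real m + 2)
          + M * ((real j + 1) * (real j + 2)) / ((real m + 2) * (real m + 3)) = e + M * v"
        by (simp add: v_def b_def kj nm divide_simps) (simp add: algebra_simps power2_eq_square)
      moreover have "e + M * b\<^sup>2 + - 2 * M * b * t + M * t\<^sup>2 = e + M * (t - b)\<^sup>2" for t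
        by (simp add: power2_eq_square algebra_simps)
      moreover have "real m + 1 = real n - 1" by (simp add: nm)
      ultimately show ?thesis
        using has_integral_Bernstein_quadratic[OF jm, of "e + M * b\<^sup>2" "- 2 * M * b" M]
        by (simp only:)
    qed
    have "continuous_on {0..1} (\<lambda>t. ?B t * f t)"
      unfolding Bernstein_def by (intro continuous_intros cont)
    then have fint: "(\<lambda>t. ?B t * f t) integrable_on {0..1}"
      by (rule integrable_continuous_real)
    have "\<bar>integral {0..1} (\<lambda>t. ?B t * f t) - c / (real n - 1)\<bar>
        = norm (integral {0..1} (\<lambda>t. ?B t * f t - ?B t * (c + d * (t - b))))"
      using integral_diff[OF fint has_integral_integrable[OF lin]] integral_unique[OF lin] by simp
    also have "\<dots> \<le> integral {0..1} (\<lambda>t. ?B t * (e + M * (t - b)\<^sup>2))"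
    proof (rule integral_norm_bound_integral)
      show "norm (?B t * f t - ?B t * (c + d * (t - b))) \<le> ?B t * (e + M * (t - b)\<^sup>2)"
        if "t \<in> {0..1}" for t
        using mult_left_mono[OF bound[OF that] Bernstein_nonneg[of t m j]] that
        by (simp add: b_def abs_mult Bernstein_nonneg flip: right_diff_distrib)
    qed (use fint lin quad in \<open>auto intro!: integrable_diff dest: has_integral_integrable\<close>)
    also have "\<dots> = (e + M * v) / (real n - 1)" by (rule integral_unique[OF quad])
    finally have "\<bar>integral {0..1} (\<lambda>t. ?B t * f t) - c / (real n - 1)\<bar> * (real n - 1) \<le> e + M * v"
      by (simp add: nm field_simps)
    moreover have "\<bar>integral {0..1} (\<lambda>t. ?B t * f t) - c / (real n - 1)\<bar> * (real n - 1)
        = \<bar>(integral {0..1} (\<lambda>t. ?B t * f t) - c / (real n - 1)) * (real n - 1)\<bar>"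
      by (simp add: nm abs_mult)
    moreover have "(integral {0..1} (\<lambda>t. ?B t * f t) - c / (real n - 1)) * (real n - 1)
        = beta_mean n f k - c"
    proof -
      have "bern m (int k - 1) = ?B" by (simp add: bern_def fun_eq_iff kj)
      moreover have "(I - c / r) * r = r * I - c" if "r \<noteq> 0" for I r :: real
        using that by (simp add: field_simps)
      moreover have "real n - 1 \<noteq> 0" by (simp add: nm)
      ultimately show ?thesis using 3
        by (simp only: beta_mean_def m_def[symmetric]) simp
    qed
    moreover have "v = real k * (real n - real k) / ((real n)\<^sup>2 * (real n + 1))"
      by (simp add: v_def b_def nm power2_eq_square divide_simps)
    ultimately show ?thesis by simp
  qed
qed

section \<open>The operators as sums of beta means, and the averaged variances\<close>

lemma sum_atMost_split_ends:
  fixes u :: "nat \<Rightarrow> 'a::comm_monoid_add"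
  assumes "1 \<le> n"
  shows "(\<Sum>k\<le>n. u k) = u 0 + u n + (\<Sum>k = 1..n - 1. u k)"
proof -
  have "{..n} = insert 0 (insert n {1..n - 1})" using assms by auto
  then show ?thesis using assms by (simp add: add_ac)
qed

lemma durrmeyer_eq_sum:
  assumes "1 \<le> n"
  shows "durrmeyer n f x = (\<Sum>k\<le>n. bern n (int k) x * beta_mean n f k)"
  unfolding sum_atMost_split_ends[OF assms] using assms
  by (auto simp: durrmeyer_def beta_mean_def bern_def Bernstein_def sum_distrib_left mult_ac
      intro!: sum.cong)

lemma durrmeyer_M_eq_sum:
  assumes "1 \<le> n"
  shows "durrmeyer_M a0 a1 n f x = (\<Sum>k\<le>n. bern_M a0 a1 n (int k) x * beta_mean n f k)"
proof -
  have "bern_M a0 a1 n 0 x = a_lin a0 a1 x n * (1 - x) ^ (n - 1)"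
    by (simp add: bern_M_def bern_def Bernstein_def)
  moreover have "bern_M a0 a1 n (int n) x = a_lin a0 a1 (1 - x) n * x ^ (n - 1)"
    using assms by (simp add: bern_M_def bern_def Bernstein_def nat_diff_distrib)
  ultimately show ?thesis
    unfolding sum_atMost_split_ends[OF assms] using assms
    by (auto simp: durrmeyer_M_def beta_mean_def sum_distrib_left mult_ac intro!: sum.cong)
qed

lemma bern_Suc: "bern (Suc m) k x = (1 - x) * bern m k x + x * bern m (k - 1) x"
proof -
  consider "k < 0" | "k = 0" | j where "k = int (Suc j)"
    by (metis nonneg_int_cases not0_implies_Suc not_le of_nat_0)
  then show ?thesis
  proof cases
    case (3 j)
    have "Bernstein (Suc m) (Suc j) x = (1 - x) * Bernstein m (Suc j) x + x * Bernstein m j x"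
    proof (cases "j < m")
      case True
      then have "m - j = Suc (m - Suc j)" by simp
      then show ?thesis by (simp add: Bernstein_def algebra_simps)
    qed (simp add: Bernstein_def algebra_simps binomial_eq_0)
    then show ?thesis by (simp add: bern_def 3 nat_add_distrib)
  qed (auto simp: bern_def Bernstein_def)
qed

text \<open>Under the constraint, the coefficients \<open>a_lin a0 a1 x n\<close> and
  \<open>a_lin a0 a1 (1 - x) n\<close> differ from those of the recurrence, \<open>1 - x\<close> and
  \<open>x\<close>, by \<open>- q\<close> and \<open>q\<close>. Shifting the index then moves the
  difference from the basis to the functionals.\<close>

lemma durrmeyer_M_minus_durrmeyer:
  assumes a: "2 * a0 (Suc m) + a1 (Suc m) = 1"
  shows "durrmeyer_M a0 a1 (Suc m) f x - durrmeyer (Suc m) f x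
    = (1 + a1 (Suc m)) * (1 / 2 - x)
      * (\<Sum>j\<le>m. Bernstein m j x * (beta_mean (Suc m) f (Suc j) - beta_mean (Suc m) f j))"
proof -
  let ?F = "beta_mean (Suc m) f"
  define q where "q = (1 + a1 (Suc m)) * (1 / 2 - x)"
  have a0: "a0 (Suc m) = (1 - a1 (Suc m)) / 2" using a by simp
  have "bern_M a0 a1 (Suc m) k x - bern (Suc m) k x = q * (bern m (k - 1) x - bern m k x)" for k
    unfolding bern_M_def bern_Suc a_lin_def a0 q_def by (simp add: field_simps)
  then have "durrmeyer_M a0 a1 (Suc m) f x - durrmeyer (Suc m) f x
      = (\<Sum>k\<le>Suc m. q * (bern m (int k - 1) x - bern m (int k) x) * ?F k)"
    by (simp only: durrmeyer_M_eq_sum durrmeyer_eq_sum le_add1 plus_1_eq_Suc[symmetric]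
        sum_subtractf[symmetric] left_diff_distrib[symmetric])
  also have "\<dots> = q * ((\<Sum>k\<le>Suc m. bern m (int k - 1) x * ?F k) - (\<Sum>k\<le>Suc m. bern m (int k) x * ?F k))"
    by (simp only: sum_subtractf[symmetric] sum_distrib_left left_diff_distrib mult.assoc)
  \<comment> \<open>The term \<open>k = 0\<close> drops out here, and the term
    \<open>k = Suc m\<close> in the other sum.\<close>
  also have "(\<Sum>k\<le>Suc m. bern m (int k - 1) x * ?F k) = (\<Sum>j\<le>m. Bernstein m j x * ?F (Suc j))"
    unfolding sum.atMost_Suc_shift by (simp add: bern_def)
  also have "(\<Sum>k\<le>Suc m. bern m (int k) x * ?F k) = (\<Sum>j\<le>m. Bernstein m j x * ?F j)"
    unfolding sum.atMost_Suc by (simp add: bern_def Bernstein_def del: of_nat_Suc)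
  finally show ?thesis by (simp add: q_def sum_subtractf right_diff_distrib)
qed

text \<open>The summed variances are quadratic in \<open>j\<close>. Written with \<open>j\<close>
  and \<open>j * (j - 1)\<close>, they average by the binomial factorial moments
  \<open>m * x\<close> and \<open>m * (m - 1) * x\<^sup>2\<close>.\<close>

lemma sum_Bernstein_variances:
  fixes m :: nat and x :: real
  defines "n \<equiv> Suc m"
  defines "V \<equiv> \<lambda>k::nat. real k * (real n - real k) / ((real n)\<^sup>2 * (real n + 1))"
  shows "(\<Sum>j\<le>m. Bernstein m j x * (V (Suc j) + V j)) = 2 * sigma n x"
proof -
  define K where "K = (real n)\<^sup>2 * (real n + 1)"
  have "Bernstein m j x * (V (Suc j) + V j)
      = (real m * Bernstein m j x + (2 * real m - 2) * (real j * Bernstein m j x)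
         - 2 * (real j * (real j - 1) * Bernstein m j x)) / K" for j
  proof -
    have "V (Suc j) + V j = (real (Suc j) * (real n - real (Suc j)) + real j * (real n - real j)) / K"
      by (simp add: V_def K_def add_divide_distrib)
    also have "real (Suc j) * (real n - real (Suc j)) + real j * (real n - real j)
        = real m + (2 * real m - 2) * real j - 2 * (real j * (real j - 1))"
      by (simp add: n_def algebra_simps)
    finally show ?thesis by (simp add: algebra_simps)
  qed
  then have "(\<Sum>j\<le>m. Bernstein m j x * (V (Suc j) + V j))
      = (real m * (\<Sum>j\<le>m. Bernstein m j x) + (2 * real m - 2) * (\<Sum>j\<le>m. real j * Bernstein m j x)
         - 2 * (\<Sum>j\<le>m. real j * (real j - 1) * Bernstein m j x)) / K"
    by (simp only: sum_divide_distrib[symmetric] sum.distrib sum_subtractf sum_distrib_left)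
  also have "\<dots> = (real m + (2 * real m - 2) * (real m * x)
         - 2 * (real m * (real m - 1) * x\<^sup>2)) / K"
    by (simp add: sum_k_Bernstein sum_kk_Bernstein)
  also have "\<dots> = 2 * sigma n x"
    by (simp add: sigma_def K_def n_def) (simp add: algebra_simps power2_eq_square)
  finally show ?thesis .
qed

section \<open>Bounds for \<open>sigma\<close> and for the moduli\<close>

lemma sigma_Suc:
  "sigma (Suc m) x = (1 + 2 * (real m - 1) * (x * (1 - x))) * real m
     / (2 * (real (Suc m))\<^sup>2 * (real m + 2))"
proof -
  have "2 * real (Suc m) * x * (1 - x) + (1 - 2 * x)\<^sup>2 = 1 + 2 * (real m - 1) * (x * (1 - x))"
    by (simp add: algebra_simps power2_eq_square)
  then show ?thesis by (simp add: sigma_def add_ac)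
qed

lemma unit_interval_product_bounds:
  fixes x :: real
  assumes "x \<in> {0..1}"
  shows "0 \<le> x * (1 - x)" "x * (1 - x) \<le> 1 / 4"
proof -
  show "0 \<le> x * (1 - x)" using assms by simp
  have "1 / 4 - x * (1 - x) = (x - 1 / 2)\<^sup>2" by (simp add: power2_eq_square algebra_simps)
  then show "x * (1 - x) \<le> 1 / 4" using zero_le_power2[of "x - 1 / 2"] by linarith
qed

lemma sigma_le:
  assumes "x \<in> {0..1}" "1 \<le> n"
  shows "sigma n x \<le> 1 / (4 * real n)"
proof -
  obtain m where n: "n = Suc m" using \<open>1 \<le> n\<close> by (cases n) auto
  show ?thesis
  \<comment> \<open>For \<open>m = 0\<close> the coefficient \<open>real m - 1\<close> is negative,
    but \<open>sigma\<close> vanishes. Otherwise \<open>x * (1 - x)\<close> may be replaced by its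
    maximum \<open>1 / 4\<close>.\<close>
  proof (cases "m = 0")
    case True
    then show ?thesis by (simp add: n sigma_Suc)
  next
    case False
    then have "2 * (real m - 1) * (x * (1 - x)) \<le> 2 * (real m - 1) * (1 / 4)"
      using unit_interval_product_bounds(2)[OF assms(1)] by (intro mult_left_mono) auto
    then have "(1 + 2 * (real m - 1) * (x * (1 - x))) * real m \<le> (real (Suc m) / 2) * (real m + 2)"
      using False unit_interval_product_bounds(1)[OF assms(1)] by (intro mult_mono) auto
    then have "sigma n x \<le> (real (Suc m) / 2) * (real m + 2) / (2 * (real (Suc m))\<^sup>2 * (real m + 2))"
      unfolding n sigma_Suc by (intro divide_right_mono) auto
    also have "\<dots> = 1 / (4 * real n)" by (simp add: n power2_eq_square divide_simps)
    finally show ?thesis .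
  qed
qed

lemma sigma_pos:
  assumes "x \<in> {0..1}" "1 < n"
  shows "0 < sigma n x"
proof -
  obtain m where n: "n = Suc m" "0 < m" using \<open>1 < n\<close> by (cases n) auto
  have "0 \<le> 2 * (real m - 1) * (x * (1 - x))"
    by (rule mult_nonneg_nonneg[OF _ unit_interval_product_bounds(1)[OF assms(1)]]) (use n in auto)
  then have "0 < 1 + 2 * (real m - 1) * (x * (1 - x))" by linarith
  then show ?thesis
    unfolding n sigma_Suc by (intro divide_pos_pos mult_pos_pos) (use n in auto)
qed

text \<open>Continuity bounds \<open>f\<close>, so the sets of differences are bounded above and the
  real \<open>Sup\<close> is a genuine supremum. A second difference is a sum of two first
  differences, which gives the comparison of the moduli.\<close>

lemma omega_bounds:
  assumes cont: "continuous_on {0..1} f"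
  shows omega1_upper: "\<And>s t. \<lbrakk>s \<in> {0..1}; t \<in> {0..1}; \<bar>s - t\<bar> \<le> \<delta>\<rbrakk> \<Longrightarrow> \<bar>f s - f t\<bar> \<le> omega1 f \<delta>"
    and omega2_upper: "\<And>t h. \<lbrakk>0 \<le> h; h \<le> \<delta>; 0 \<le> t - h; t + h \<le> 1\<rbrakk>
          \<Longrightarrow> \<bar>f (t - h) - 2 * f t + f (t + h)\<bar> \<le> omega2 f \<delta>"
    and omega2_le_omega1: "0 \<le> \<delta> \<Longrightarrow> omega2 f \<delta> \<le> 2 * omega1 f \<delta>"
proof -
  have "bounded (f ` {0..1})"
    by (intro compact_imp_bounded compact_continuous_image cont) auto
  then obtain K where "\<forall>y\<in>f ` {0..1}. norm y \<le> K"
    unfolding bounded_iff by blast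
  then have K: "\<And>t. t \<in> {0..1} \<Longrightarrow> \<bar>f t\<bar> \<le> K" by simp
  show up1: "\<bar>f s - f t\<bar> \<le> omega1 f \<delta>" if "s \<in> {0..1}" "t \<in> {0..1}" "\<bar>s - t\<bar> \<le> \<delta>" for s t
    unfolding omega1_def
  proof (rule cSup_upper)
    show "bdd_above {\<bar>f s - f t\<bar> |s t. s \<in> {0..1} \<and> t \<in> {0..1} \<and> \<bar>s - t\<bar> \<le> \<delta>}"
    proof (rule bdd_aboveI)
      fix y assume "y \<in> {\<bar>f s - f t\<bar> |s t. s \<in> {0..1} \<and> t \<in> {0..1} \<and> \<bar>s - t\<bar> \<le> \<delta>}"
      then obtain s t where "y = \<bar>f s - f t\<bar>" "s \<in> {0..1}" "t \<in> {0..1}" by blast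
      then show "y \<le> 2 * K" using K[of s] K[of t] by linarith
    qed
  qed (use that in blast)
  show "\<bar>f (t - h) - 2 * f t + f (t + h)\<bar> \<le> omega2 f \<delta>"
    if "0 \<le> h" "h \<le> \<delta>" "0 \<le> t - h" "t + h \<le> 1" for t h
    unfolding omega2_def
  proof (rule cSup_upper)
    show "bdd_above {\<bar>f (t - h) - 2 * f t + f (t + h)\<bar> |t h.
        0 \<le> h \<and> h \<le> \<delta> \<and> t - h \<in> {0..1} \<and> t + h \<in> {0..1}}"
    proof (rule bdd_aboveI)
      fix y assume "y \<in> {\<bar>f (t - h) - 2 * f t + f (t + h)\<bar> |t h.
        0 \<le> h \<and> h \<le> \<delta> \<and> t - h \<in> {0..1} \<and> t + h \<in> {0..1}}"
      then obtain t h where y: "y = \<bar>f (t - h) - 2 * f t + f (t + h)\<bar>"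
        and "0 \<le> h" and th: "t - h \<in> {0..1}" "t + h \<in> {0..1}" by blast
      then have "t \<in> {0..1}" by auto
      then show "y \<le> 4 * K" using K[of t] K[OF th(1)] K[OF th(2)] y by linarith
    qed
    show "\<bar>f (t - h) - 2 * f t + f (t + h)\<bar> \<in> {\<bar>f (t - h) - 2 * f t + f (t + h)\<bar> |t h.
        0 \<le> h \<and> h \<le> \<delta> \<and> t - h \<in> {0..1} \<and> t + h \<in> {0..1}}"
      by (rule CollectI, rule exI[of _ t], rule exI[of _ h]) (use that in auto)
  qed
  show "omega2 f \<delta> \<le> 2 * omega1 f \<delta>" if "0 \<le> \<delta>"
    unfolding omega2_def
  proof (rule cSup_least)
    show "{\<bar>f (t - h) - 2 * f t + f (t + h)\<bar> |t h.
        0 \<le> h \<and> h \<le> \<delta> \<and> t - h \<in> {0..1} \<and> t + h \<in> {0..1}} \<noteq> {}"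
      using that by (auto intro!: exI[of _ "0::real"])
    fix y assume "y \<in> {\<bar>f (t - h) - 2 * f t + f (t + h)\<bar> |t h.
        0 \<le> h \<and> h \<le> \<delta> \<and> t - h \<in> {0..1} \<and> t + h \<in> {0..1}}"
    then obtain t h where y: "y = \<bar>f (t - h) - 2 * f t + f (t + h)\<bar>"
      and h: "0 \<le> h" "h \<le> \<delta>" "t - h \<in> {0..1}" "t + h \<in> {0..1}" by blast
    then have "\<bar>f (t - h) - f t\<bar> \<le> omega1 f \<delta>" "\<bar>f (t + h) - f t\<bar> \<le> omega1 f \<delta>"
      by (auto intro!: up1)
    then show "y \<le> 2 * omega1 f \<delta>" using y by linarith
  qed
qed

subsection \<open>The estimate\<close>

lemma beta_mean_increment_bound:
  assumes n: "2 \<le> n" and x: "x \<in> {0..1}" and cont: "continuous_on {0..1} f"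
  shows "\<bar>\<Sum>j\<le>n - 1. Bernstein (n - 1) j x * (beta_mean n f (Suc j) - beta_mean n f j)\<bar>
    \<le> 3 * omega2 f (sqrt (sigma n x))
      + 5 / (real n * sqrt (sigma n x)) * omega1 f (sqrt (sigma n x))"
proof -
  obtain m where nm: "n = Suc m" using n by (cases n) auto
  define h where "h = sqrt (sigma n x)"
  define w1 where "w1 = omega1 f h"
  define w2 where "w2 = omega2 f h"
  have "0 < sigma n x" using sigma_pos[OF x] n by simp
  then have h0: "0 < h" and h2: "h\<^sup>2 = sigma n x" by (auto simp: h_def)
  \<comment> \<open>This gives \<open>h \<le> 1 / 2\<close>, so that the end intervals of length
    \<open>2 * h\<close> in the smoothing fit into the unit interval.\<close>
  have "sigma n x \<le> 1 / (4 * real n)" using n by (intro sigma_le x) simp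
  also have "\<dots> \<le> 1 / (4 * 1)" using n by (intro divide_left_mono) auto
  finally have "sigma n x \<le> 1 / 4" by simp
  then have "h\<^sup>2 \<le> (1 / 2)\<^sup>2" unfolding h2 by (simp add: power2_eq_square)
  then have hle: "h \<le> 1 / 2" by (rule power2_le_imp_le) simp
  obtain g g' where
    dg: "\<And>x. x \<in> {0..1} \<Longrightarrow> (g has_real_derivative g' x) (at x)"
    and fg: "\<And>x. x \<in> {0..1} \<Longrightarrow> \<bar>f x - g x\<bar> \<le> 3 / 4 * w2"
    and g'_bound: "\<And>x. x \<in> {0..1} \<Longrightarrow> \<bar>g' x\<bar> \<le> 5 / h * w1"
    and g'_lip: "\<And>x y. x \<in> {0..1} \<Longrightarrow> y \<in> {0..1}
                   \<Longrightarrow> \<bar>g' x - g' y\<bar> \<le> 3 / 2 * w2 / h\<^sup>2 * \<bar>x - y\<bar>"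
    by (rule Zhuk_smoothing[OF h0 hle cont omega1_upper[OF cont] omega2_upper[OF cont]
          omega2_le_omega1[OF cont less_imp_le[OF h0]], folded w1_def w2_def]) (assumption+, rule that)
  \<comment> \<open>Half the Lipschitz constant of \<open>g'\<close>, the quadratic coefficient in
    Taylor's bound.\<close>
  define M where "M = 3 / 2 * w2 / h\<^sup>2 / 2"
  define V where "V k = real k * (real n - real k) / ((real n)\<^sup>2 * (real n + 1))" for k
  let ?F = "beta_mean n f"
  have near: "\<bar>?F k - g (real k / real n)\<bar> \<le> 3 / 4 * w2 + M * V k" if "k \<le> n" for k
    unfolding V_def
  proof (rule beta_mean_near_linear[OF that cont])
    fix t :: real assume t: "t \<in> {0..1}"
    let ?b = "real k / real n"
    have b: "?b \<in> {0..1}" using that n by (auto simp: divide_le_eq)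
    have "\<bar>g t - g ?b - g' ?b * (t - ?b)\<bar> \<le> M * (t - ?b)\<^sup>2"
      unfolding M_def
      by (rule Taylor_bound_Lipschitz_derivative[OF b t dg g'_lip[OF _ b]])
    then show "\<bar>f t - (g ?b + g' ?b * (t - ?b))\<bar> \<le> 3 / 4 * w2 + M * (t - ?b)\<^sup>2"
      using fg[OF t] by linarith
  qed
  \<comment> \<open>Two smoothing errors of \<open>3 / 4 * w2\<close>, plus the slope bound
    \<open>5 / h * w1\<close> over a distance of \<open>1 / n\<close>, plus the two variance
    terms.\<close>
  have step: "\<bar>?F (Suc j) - ?F j\<bar> \<le> (3 / 2 * w2 + 5 / (real n * h) * w1) + M * (V (Suc j) + V j)"
    if "j \<le> m" for j
  proof -
    let ?a = "real j / real n" and ?b = "real (Suc j) / real n"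
    have ab: "0 \<le> ?a" "?a \<le> ?b" "?b \<le> 1"
      using that by (auto simp: nm divide_le_eq intro!: divide_right_mono)
    have sub: "t \<in> {0..1}" if "?a \<le> t" "t \<le> ?b" for t
      using order_trans[OF ab(1) that(1)] order_trans[OF that(2) ab(3)] by simp
    have "\<bar>g ?b - g ?a\<bar> \<le> 5 / h * w1 * (?b - ?a)"
    proof (rule increment_bound_finite_exceptions[where S = "{}" and \<phi>' = g'])
      show "continuous_on {?a..?b} g"
        by (rule DERIV_continuous_on[OF has_field_derivative_at_within[OF dg[OF sub]]]) simp_all
      show "0 \<le> 5 / h * w1" using g'_bound[of 0] by auto
      show "(g has_real_derivative g' t) (at t)" "\<bar>g' t\<bar> \<le> 5 / h * w1"
        if "t \<in> {?a<..<?b} - {}" for t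
        using dg[OF sub, of t] g'_bound[OF sub, of t] that by simp_all
    qed (use ab(2) in simp_all)
    also have "?b - ?a = 1 / real n" by (simp flip: diff_divide_distrib)
    finally have "\<bar>g ?b - g ?a\<bar> \<le> 5 / (real n * h) * w1" by (simp add: mult_ac)
    moreover have "Suc j \<le> n" "j \<le> n" using that nm by auto
    ultimately show ?thesis
      using near[of "Suc j"] near[of j] unfolding distrib_left by linarith
  qed
  have "\<bar>\<Sum>j\<le>m. Bernstein m j x * (?F (Suc j) - ?F j)\<bar>
      \<le> (\<Sum>j\<le>m. \<bar>Bernstein m j x * (?F (Suc j) - ?F j)\<bar>)"
    by (rule sum_abs)
  also have "\<dots> \<le> (\<Sum>j\<le>m. Bernstein m j x
      * ((3 / 2 * w2 + 5 / (real n * h) * w1) + M * (V (Suc j) + V j)))"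
  proof (rule sum_mono)
    fix j assume "j \<in> {..m}"
    then have "\<bar>Bernstein m j x\<bar> * \<bar>?F (Suc j) - ?F j\<bar>
        \<le> \<bar>Bernstein m j x\<bar> * ((3 / 2 * w2 + 5 / (real n * h) * w1) + M * (V (Suc j) + V j))"
      by (intro mult_left_mono step) auto
    moreover have "\<bar>Bernstein m j x\<bar> = Bernstein m j x" using x by (simp add: Bernstein_nonneg)
    ultimately show "\<bar>Bernstein m j x * (?F (Suc j) - ?F j)\<bar>
        \<le> Bernstein m j x * ((3 / 2 * w2 + 5 / (real n * h) * w1) + M * (V (Suc j) + V j))"
      by (simp only: abs_mult)
  qed
  \<comment> \<open>The weights sum to one and the variances average to
    \<open>2 * h\<^sup>2\<close>, which cancels the \<open>h\<^sup>2\<close> in \<open>M\<close>: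
    another \<open>3 / 2 * w2\<close>, hence the constant 3.\<close>
  also have "\<dots> = (\<Sum>j\<le>m. Bernstein m j x) * (3 / 2 * w2 + 5 / (real n * h) * w1)
      + M * (\<Sum>j\<le>m. Bernstein m j x * (V (Suc j) + V j))"
    unfolding sum_distrib_left sum_distrib_right sum.distrib[symmetric]
    by (rule sum.cong) (simp_all add: distrib_left mult.left_commute)
  also have "(\<Sum>j\<le>m. Bernstein m j x * (V (Suc j) + V j)) = 2 * h\<^sup>2"
    using sum_Bernstein_variances[of m x] unfolding V_def h2 nm by simp
  also have "M * (2 * h\<^sup>2) = 3 / 2 * w2" using h0 by (simp add: M_def)
  finally show ?thesis by (simp add: nm w1_def w2_def h_def)
qed

theorem theorem8p1:
  fixes a0 a1 :: "nat \<Rightarrow> real" and f :: "real \<Rightarrow> real" and x :: real and n :: nat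
  assumes "\<forall>m\<ge>1. 2 * a0 m + a1 m = 1"
    and "continuous_on {0..1} f"
    and "x \<in> {0..1}"
    and "n \<ge> 1"
  shows "(sigma n x \<noteq> 0 \<longrightarrow>
           \<bar>durrmeyer_M a0 a1 n f x - f x\<bar>
             \<le> \<bar>durrmeyer n f x - f x\<bar>
                + \<bar>(1 + a1 n) * (1 / 2 - x)\<bar>
                  * (3 * omega2 f (sqrt (sigma n x))
                     + 5 / (real n * sqrt (sigma n x)) * omega1 f (sqrt (sigma n x))))
         \<and> sigma n x \<le> 1 / (4 * real n)"
proof (intro conjI impI)
  show "sigma n x \<le> 1 / (4 * real n)" using assms by (intro sigma_le)
next
  assume nz: "sigma n x \<noteq> 0"
  \<comment> \<open>The factor \<open>real n - 1\<close> of \<open>sigma\<close> vanishes for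
    \<open>n = 1\<close>.\<close>
  have "n \<noteq> 1" using nz by (auto simp: sigma_def)
  then have n: "2 \<le> n" using \<open>n \<ge> 1\<close> by simp
  let ?D = "\<Sum>j\<le>n - 1. Bernstein (n - 1) j x * (beta_mean n f (Suc j) - beta_mean n f j)"
  let ?R = "3 * omega2 f (sqrt (sigma n x))
    + 5 / (real n * sqrt (sigma n x)) * omega1 f (sqrt (sigma n x))"
  let ?q = "(1 + a1 n) * (1 / 2 - x)"
  have "durrmeyer_M a0 a1 n f x - durrmeyer n f x = ?q * ?D"
    using durrmeyer_M_minus_durrmeyer[of a0 "n - 1" a1 f x] assms(1) n by simp
  moreover have "\<bar>?q * ?D\<bar> \<le> \<bar>?q\<bar> * ?R"
    unfolding abs_mult[of ?q]
    by (intro mult_left_mono beta_mean_increment_bound n assms) auto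
  ultimately show "\<bar>durrmeyer_M a0 a1 n f x - f x\<bar> \<le> \<bar>durrmeyer n f x - f x\<bar> + \<bar>?q\<bar> * ?R"
    by linarith
qed

end
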